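(* Let $a,b,c\in\mathbb{R}$ and let $f(x,y,z)=w_4+a w_3+b w_2+c w_1$. If $f(x,y,z)\ge 0$ for all $x,y,z\in\mathbb{R}$, then $b\ge -2a-c-1$. Moreover, if $c\le -a^2-2a$, then this condition is also sufficient: if $c\le -a^2-2a$ and $b\ge -2a-c-1$, then $f(x,y,z)\ge 0$ for all $x,y,z\in\mathbb{R}$.
   Context: For real $x,y,z$: $w_4=x^4+y^4+z^4$, $w_3=x^3y+y^3z+z^3x+xy^3+yz^3+zx^3$, $w_2=x^2y^2+y^2z^2+z^2x^2$, $w_1=xyz(x+y+z)$. *)

theory Defs
  imports Complex_Main
begin

definition w4 :: "real \<Rightarrow> real \<Rightarrow> real \<Rightarrow> real" where
  "w4 x y z = x^4 + y^4 + z^4"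

definition w3 :: "real \<Rightarrow> real \<Rightarrow> real \<Rightarrow> real" where
  "w3 x y z = x^3*y + y^3*z + z^3*x + x*y^3 + y*z^3 + z*x^3"

definition w2 :: "real \<Rightarrow> real \<Rightarrow> real \<Rightarrow> real" where
  "w2 x y z = x^2*y^2 + y^2*z^2 + z^2*x^2"

definition w1 :: "real \<Rightarrow> real \<Rightarrow> real \<Rightarrow> real" where
  "w1 x y z = x*y*z*(x + y + z)"

definition sym_quartic :: "real \<Rightarrow> real \<Rightarrow> real \<Rightarrow> real \<Rightarrow> real \<Rightarrow> real \<Rightarrow> real" where
  "sym_quartic a b c x y z = w4 x y z + a * w3 x y z + b * w2 x y z + c * w1 x y z"

end

(* Necessity is evaluation at (1,1,1). For sufficiency, f is linear in b and c, and on the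
   extremal values c = -a^2 - 2a, b = -2a - c - 1 it equals half the sum of the squares
   ((x - y)(x + y + a z))^2 over the cyclic permutations of x, y, z; the slack in b contributes
   a multiple of w2, the slack in c a multiple of w2 - w1. *)
theory Submission
  imports Defs
begin

text \<open>Write each factor product as \<open>(x^2 - y^2) + a*z*(x - y)\<close>. In the half sum
  of squares the pure parts give \<open>w4 - w2\<close> and \<open>a^2 * (w2 - w1)\<close>, the
  cross terms \<open>a * (w3 - 2*w1)\<close>.\<close>

lemma sym_quartic_sos:
  "sym_quartic a b c x y z =
     (((x - y) * (x + y + a*z))^2 + ((y - z) * (y + z + a*x))^2 + ((z - x) * (z + x + a*y))^2) / 2
     + (-(a^2) - 2*a - c) * (((x*y - y*z)^2 + (y*z - z*x)^2 + (z*x - x*y)^2) / 2)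
     + (b + 2*a + c + 1) * ((x*y)^2 + (y*z)^2 + (z*x)^2)"
  unfolding sym_quartic_def w4_def w3_def w2_def w1_def
  by (simp add: field_simps) algebra

theorem theorem1:
  fixes a b c :: real
  shows "((\<forall>x y z :: real. sym_quartic a b c x y z \<ge> 0) \<longrightarrow> b \<ge> -2*a - c - 1) \<and>
    (c \<le> -(a^2) - 2*a \<and> b \<ge> -2*a - c - 1 \<longrightarrow>
      (\<forall>x y z :: real. sym_quartic a b c x y z \<ge> 0))"
proof (intro conjI impI allI)
  assume "\<forall>x y z :: real. sym_quartic a b c x y z \<ge> 0"
  then have "sym_quartic a b c 1 1 1 \<ge> 0"
    by blast
  \<comment> \<open>The value at (1,1,1) is \<open>3 * (1 + 2*a + b + c)\<close>.\<close>
  then show "b \<ge> -2*a - c - 1"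
    by (simp add: sym_quartic_def w4_def w3_def w2_def w1_def)
next
  fix x y z :: real
  assume "c \<le> -(a^2) - 2*a \<and> b \<ge> -2*a - c - 1"
  then have slack: "-(a^2) - 2*a - c \<ge> 0" "b + 2*a + c + 1 \<ge> 0"
    by linarith+
  show "sym_quartic a b c x y z \<ge> 0"
    unfolding sym_quartic_sos
    \<comment> \<open>Both coefficients are nonnegative by \<open>slack\<close>; all other factors
      are sums of squares, up to a half.\<close>
    by (rule add_nonneg_nonneg mult_nonneg_nonneg slack | simp)+
qed

end
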